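(* Let $\alpha\in(0,1)$ and let $K=K_0+K_1$ with $K_0,K_1\ge 1$. Suppose that $\tilde Z_1,\dots,\tilde Z_{K+1}\in\tilde{\mathcal Z}$ satisfies hierarchical exchangeability. Run hierarchical conformal prediction (HCP) at level $\alpha$ with training data $\tilde Z_1,\dots,\tilde Z_{K_0}$, calibration data $\tilde Z_{K_0+1},\dots,\tilde Z_K$, and test point $Z_{\mathrm{test}}=(X_{\mathrm{test}},Y_{\mathrm{test}})=\tilde Z_{K+1,1}$ (the first entry of $\tilde Z_{K+1}$), and let $\widehat C(X_{\mathrm{test}})$ be the resulting prediction set. Then $$\mathbb P\{Y_{\mathrm{test}}\in\widehat C(X_{\mathrm{test}})\}\ge 1-\alpha.$$ Moreover, if the scores $s(Z_{k,i})$ (for $k=K_0+1,\dots,K+1$ and $i=1,\dots,N_k$) are distinct almost surely, then additionally $$\mathbb P\{Y_{\mathrm{test}}\in\widehat C(X_{\mathrm{test}})\}\le 1-\alpha+\frac{2}{K_1+1}.$$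
   Context: Data. $\mathcal Z=\mathcal X\times\mathcal Y$ is a measurable space (features times responses), and $\tilde{\mathcal Z}=\mathcal Z\cup\mathcal Z^2\cup\mathcal Z^3\cup\cdots$ is the set of all nonempty finite sequences in $\mathcal Z$. For $\tilde z\in\tilde{\mathcal Z}$, $\mathrm{length}(\tilde z)$ is its length. Write $\tilde Z_k=(Z_{k,1},\dots,Z_{k,N_k})$ with $N_k=\mathrm{length}(\tilde Z_k)$ (random) and $Z_{k,i}=(X_{k,i},Y_{k,i})$. Hierarchical exchangeability. Random elements $\tilde Z_1,\dots,\tilde Z_{K+1}$ of $\tilde{\mathcal Z}$ with a joint distribution satisfy hierarchical exchangeability if (i) $(\tilde Z_1,\dots,\tilde Z_{K+1})$ has the same distribution as $(\tilde Z_{\sigma(1)},\dots,\tilde Z_{\sigma(K+1)})$ for every permutation $\sigma$ of $\{1,\dots,K+1\}$; and (ii) for every $k\in\{1,\dots,K+1\}$, every $m\ge1$ with $\mathbb P\{\mathrm{length}(\tilde Z_k)=m\}>0$, and every permutation $\sigma$ of $\{1,\dots,m\}$, conditionally on $\mathrm{length}(\tilde Z_k)=m$ the sequence $(\tilde Z_1,\dots,\tilde Z_k,\dots,\tilde Z_{K+1})$ has the same distribution as the sequence obtained by replacing $\tilde Z_k$ by $(\tilde Z_{k,\sigma(1)},\dots,\tilde Z_{k,\sigma(m)})$. Quantile. $\delta_t$ is the point mass at $t$. For a distribution $P$ on $\mathbb R\cup\{+\infty\}$, $Q_{1-\alpha}(P)=\inf\{t\in\mathbb R:\mathbb P_{T\sim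 P}\{T\le t\}\ge 1-\alpha\}$, with $\inf\emptyset=+\infty$. HCP at level $\alpha$. First, a (measurable) score function $s:\mathcal Z\to\mathbb R$ is constructed by an arbitrary procedure, as a function of the training groups $\tilde Z_1,\dots,\tilde Z_{K_0}$ only. Then $$\widehat C(X_{\mathrm{test}})=\{y\in\mathcal Y: s(X_{\mathrm{test}},y)\le T\},\qquad T=Q_{1-\alpha}\Big(\sum_{k=K_0+1}^K\sum_{i=1}^{N_k}\frac{1}{(K_1+1)N_k}\,\delta_{s(Z_{k,i})}+\frac{1}{K_1+1}\,\delta_{+\infty}\Big).$$ *)

theory Defs
  imports "HOL-Probability.Probability" "HOL-Combinatorics.Permutations"
begin

text \<open>
  The nonempty finite sequences in \<open>space M\<close>, as lists. The generators are the measurable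
  rectangles of every dimension \<open>m \<ge> 1\<close>, so this is the disjoint union of the product
  \<open>\<sigma>\<close>-algebras on the \<open>m\<close>-fold powers of \<open>M\<close>. List positions count from \<open>0\<close>.
\<close>

definition seq_space :: "'z measure \<Rightarrow> 'z list measure" where
  "seq_space M = sigma {zs \<in> lists (space M). zs \<noteq> []}
     {listset As | As. As \<noteq> [] \<and> set As \<subseteq> sets M}"

text \<open>
  In condition (ii) the conditional probabilities only see outcomes where \<open>Z k\<close> has length \<open>m\<close>,
  so \<^const>\<open>permute_list\<close> never indexes out of range there.
\<close>

definition hierarchically_exchangeable ::
    "'w measure \<Rightarrow> 'z measure \<Rightarrow> nat \<Rightarrow> (nat \<Rightarrow> 'w \<Rightarrow> 'z list) \<Rightarrow> bool" where
  "hierarchically_exchangeable P M n Z \<longleftrightarrow>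
     (\<forall>\<sigma>. \<sigma> permutes {1..n} \<longrightarrow>
        distr P (\<Pi>\<^sub>M j\<in>{1..n}. seq_space M) (\<lambda>\<omega>. \<lambda>j\<in>{1..n}. Z j \<omega>) =
        distr P (\<Pi>\<^sub>M j\<in>{1..n}. seq_space M) (\<lambda>\<omega>. \<lambda>j\<in>{1..n}. Z (\<sigma> j) \<omega>)) \<and>
     (\<forall>k\<in>{1..n}. \<forall>m\<ge>1. \<forall>\<sigma>.
        \<P>(\<omega> in P. length (Z k \<omega>) = m) > 0 \<longrightarrow> \<sigma> permutes {..<m} \<longrightarrow>
        (\<forall>B \<in> sets (\<Pi>\<^sub>M j\<in>{1..n}. seq_space M).
           \<P>(\<omega> in P. (\<lambda>j\<in>{1..n}. Z j \<omega>) \<in> B \<bar> length (Z k \<omega>) = m) =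
           \<P>(\<omega> in P. (\<lambda>j\<in>{1..n}. if j = k then permute_list \<sigma> (Z k \<omega>) else Z j \<omega>) \<in> B
              \<bar> length (Z k \<omega>) = m)))"

text \<open>
  The infimum ranges over real thresholds only, but is taken in \<^typ>\<open>ereal\<close>, so that
  it is \<open>\<infinity>\<close> when no real threshold qualifies.
\<close>

definition quantile :: "real \<Rightarrow> ereal measure \<Rightarrow> ereal" where
  "quantile p D = Inf (ereal ` {t. measure D {..ereal t} \<ge> p})"

definition calibration_dist ::
    "nat \<Rightarrow> nat \<Rightarrow> ('z \<Rightarrow> real) \<Rightarrow> (nat \<Rightarrow> 'z list) \<Rightarrow> ereal measure" where
  "calibration_dist K\<^sub>0 K\<^sub>1 s zs = measure_of UNIV (sets borel) (\<lambda>A.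
     (\<Sum>k = K\<^sub>0 + 1..K\<^sub>0 + K\<^sub>1. \<Sum>i<length (zs k).
        ennreal (1 / ((real K\<^sub>1 + 1) * real (length (zs k)))) *
          emeasure (return borel (ereal (s (zs k ! i)))) A) +
     ennreal (1 / (real K\<^sub>1 + 1)) * emeasure (return borel \<infinity>) A)"

lemma space_calibration_dist [simp]: "space (calibration_dist K\<^sub>0 K\<^sub>1 s zs) = UNIV"
  by (simp add: calibration_dist_def)

lemma sets_calibration_dist [simp, measurable_cong]:
  "sets (calibration_dist K\<^sub>0 K\<^sub>1 s zs) = sets borel"
  using sets.sets_measure_of_eq[of "borel :: ereal measure"]
  by (simp add: calibration_dist_def)

text \<open>The set function in the definition is countably additive, so it is the actual measure.\<close>

lemma emeasure_calibration_dist: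
  assumes "A \<in> sets borel"
  shows "emeasure (calibration_dist K\<^sub>0 K\<^sub>1 s zs) A =
     (\<Sum>k = K\<^sub>0 + 1..K\<^sub>0 + K\<^sub>1. \<Sum>i<length (zs k).
        ennreal (1 / ((real K\<^sub>1 + 1) * real (length (zs k)))) *
          emeasure (return borel (ereal (s (zs k ! i)))) A) +
     ennreal (1 / (real K\<^sub>1 + 1)) * emeasure (return borel \<infinity>) A"
    (is "_ = ?\<mu> A")
proof (rule emeasure_measure_of[OF calibration_dist_def])
  let ?S = "sets (calibration_dist K\<^sub>0 K\<^sub>1 s zs)"
  show "sets borel \<subseteq> Pow UNIV" by simp
  show "A \<in> ?S" using assms by simp
  show "positive ?S ?\<mu>"
    by (simp add: positive_def)
  show "countably_additive ?S ?\<mu>"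
  proof (rule countably_additiveI)
    fix B :: "nat \<Rightarrow> ereal set"
    assume B: "range B \<subseteq> ?S" "disjoint_family B"
    have r: "emeasure (return borel x) (\<Union>(range B)) = (\<Sum>n. emeasure (return borel x) (B n))"
      for x :: ereal
      using B by (intro suminf_emeasure[symmetric]) auto
    show "(\<Sum>n. ?\<mu> (B n)) = ?\<mu> (\<Union>(range B))"
      unfolding r
      by (simp add: ennreal_suminf_cmult suminf_add[symmetric] suminf_sum)
  qed
qed

lemma prob_space_calibration_dist:
  assumes "\<And>k. k \<in> {K\<^sub>0 + 1..K\<^sub>0 + K\<^sub>1} \<Longrightarrow> zs k \<noteq> []"
  shows "prob_space (calibration_dist K\<^sub>0 K\<^sub>1 s zs)"
proof (rule prob_spaceI)
  have g: "(\<Sum>i<length (zs k). ennreal (1 / ((real K\<^sub>1 + 1) * real (length (zs k))))) =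
      ennreal (1 / (real K\<^sub>1 + 1))" if "k \<in> {K\<^sub>0 + 1..K\<^sub>0 + K\<^sub>1}" for k
    using assms[OF that] by (subst sum_ennreal) auto
  have "emeasure (calibration_dist K\<^sub>0 K\<^sub>1 s zs) UNIV =
      (\<Sum>k = K\<^sub>0 + 1..K\<^sub>0 + K\<^sub>1. \<Sum>i<length (zs k).
         ennreal (1 / ((real K\<^sub>1 + 1) * real (length (zs k))))) + ennreal (1 / (real K\<^sub>1 + 1))"
    by (subst emeasure_calibration_dist) (auto simp: emeasure_return)
  also have "\<dots> = (\<Sum>k = K\<^sub>0 + 1..K\<^sub>0 + K\<^sub>1. ennreal (1 / (real K\<^sub>1 + 1))) + ennreal (1 / (real K\<^sub>1 + 1))"
    by (intro arg_cong2[where f = "(+)"] sum.cong g refl)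
  also have "\<dots> = ennreal (\<Sum>k = K\<^sub>0 + 1..K\<^sub>0 + K\<^sub>1. 1 / (real K\<^sub>1 + 1)) + ennreal (1 / (real K\<^sub>1 + 1))"
    by (subst sum_ennreal) auto
  also have "\<dots> = ennreal (real K\<^sub>1 / (real K\<^sub>1 + 1) + 1 / (real K\<^sub>1 + 1))"
    by (subst ennreal_plus[symmetric]) auto
  also have "real K\<^sub>1 / (real K\<^sub>1 + 1) + 1 / (real K\<^sub>1 + 1) = 1"
    by (simp add: field_simps)
  finally show "emeasure (calibration_dist K\<^sub>0 K\<^sub>1 s zs) (space (calibration_dist K\<^sub>0 K\<^sub>1 s zs)) = 1"
    by simp
qed

text \<open>
  \<open>S\<close> is the procedure that turns the training groups into a score function. It is applied to the
  family of groups restricted to \<open>{1..K\<^sub>0}\<close>, so it cannot depend on any other group.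
\<close>

definition hcp_set ::
    "'y measure \<Rightarrow> nat \<Rightarrow> nat \<Rightarrow> real \<Rightarrow> ((nat \<Rightarrow> ('x \<times> 'y) list) \<Rightarrow> 'x \<times> 'y \<Rightarrow> real) \<Rightarrow>
     (nat \<Rightarrow> ('x \<times> 'y) list) \<Rightarrow> 'x \<Rightarrow> 'y set" where
  "hcp_set Y K\<^sub>0 K\<^sub>1 \<alpha> S zs x =
     (let s = S (\<lambda>k\<in>{1..K\<^sub>0}. zs k);
          T = quantile (1 - \<alpha>) (calibration_dist K\<^sub>0 K\<^sub>1 s zs)
      in {y \<in> space Y. ereal (s (x, y)) \<le> T})"

end

theory Submission
  imports Defs
begin

text \<open>
  Fix the score function \<open>s\<close> learned from the training groups, and let \<open>J\<close> consist of the
  calibration groups together with the test group, so that \<open>J\<close> has \<open>K\<^sub>1 + 1\<close> members. Give every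
  group in \<open>J\<close> the weight \<open>1 / (K\<^sub>1 + 1)\<close>, shared equally by its observations. The rank of an
  observation \<open>z\<close> is the total weight \<open>W z\<close> of the observations whose score is strictly below
  \<open>s z\<close> (\<open>mass_below\<close>).

  A real \<open>x\<close> is at most the conformal threshold exactly when the calibration groups alone put weight
  less than \<open>1 - \<alpha>\<close> strictly below \<open>x\<close> (\<open>le_quantile_calibration_dist_iff\<close>). This weight differs
  from \<open>W\<close> only by the contribution of the test group, which lies between \<open>0\<close> and
  \<open>1 / (K\<^sub>1 + 1)\<close>. Hence \<open>W < 1 - \<alpha>\<close> at the test point implies coverage, and coverage implies
  \<open>W < 1 - \<alpha> + 1 / (K\<^sub>1 + 1)\<close>.

  The function \<open>W\<close> is unchanged when two groups of \<open>J\<close> are swapped or when the observations inside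
  a group are rearranged. By hierarchical exchangeability the test point may therefore be replaced
  by any observation of the same group and then by any group of \<open>J\<close>: the probability that \<open>W\<close> at
  the test point has some property is the expected total weight of the observations for which \<open>W\<close>
  has it (\<open>prob_hd_eq_expectation_hierarchical_mean\<close>).

  That total weight is bounded for every single outcome. The observations with \<open>W \<ge> p\<close> are those
  with scores at or above the smallest such score \<open>s z\<close>, so they weigh \<open>1 - W z \<le> 1 - p\<close>
  (\<open>hierarchical_mean_high_rank_le\<close>). The observations with \<open>W < q\<close> are those with scores at or below
  the largest such score \<open>s z\<close>; they weigh \<open>W z < q\<close> plus the weight of the score \<open>s z\<close> itself,
  which is at most \<open>1 / (K\<^sub>1 + 1)\<close> when the scores are distinct (\<open>hierarchical_mean_low_rank_le\<close>).
  Taking \<open>p = 1 - \<alpha>\<close> gives the lower bound on the coverage, and \<open>q = 1 - \<alpha> + 1 / (K\<^sub>1 + 1)\<close> gives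
  the upper bound.
\<close>

section \<open>Means over groups\<close>

definition mean :: "('z \<Rightarrow> real) \<Rightarrow> 'z list \<Rightarrow> real" where
  "mean f xs = (\<Sum>x\<leftarrow>xs. f x) / real (length xs)"

text \<open>
  Groups are weighted equally whatever their length, as in the calibration distribution; for
  indicator functions, finite nonempty \<open>J\<close> and nonempty groups, this is a probability measure on
  the observations of the groups in \<open>J\<close>.
\<close>

definition hierarchical_mean :: "nat set \<Rightarrow> ('z \<Rightarrow> real) \<Rightarrow> (nat \<Rightarrow> 'z list) \<Rightarrow> real" where
  "hierarchical_mean J f zs = (\<Sum>k\<in>J. mean f (zs k)) / real (card J)"

lemma mean_mono:
  assumes "\<And>x. x \<in> set xs \<Longrightarrow> f x \<le> g x"
  shows "mean f xs \<le> mean g xs"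
  unfolding mean_def using assms by (intro divide_right_mono sum_list_mono) auto

lemma mean_const: "xs \<noteq> [] \<Longrightarrow> mean (\<lambda>_. c) xs = c"
  by (simp add: mean_def sum_list_triv)

lemma mean_bounds:
  assumes "xs \<noteq> []" "\<And>x. x \<in> set xs \<Longrightarrow> 0 \<le> f x" "\<And>x. x \<in> set xs \<Longrightarrow> f x \<le> 1"
  shows "0 \<le> mean f xs" "mean f xs \<le> 1"
  using mean_mono[of xs "\<lambda>_. 0" f] mean_mono[of xs f "\<lambda>_. 1"] assms by (auto simp: mean_const)

lemma mean_add: "mean (\<lambda>x. f x + g x) xs = mean f xs + mean g xs"
  by (simp add: mean_def sum_list_addf add_divide_distrib)

lemma mean_permute_list:
  assumes "\<sigma> permutes {..<length xs}"
  shows "mean f (permute_list \<sigma> xs) = mean f xs"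
proof -
  have "(\<Sum>x\<leftarrow>permute_list \<sigma> xs. f x) = (\<Sum>x\<leftarrow>xs. f x)"
    using assms by (metis mset_permute_list mset_map sum_mset_sum_list)
  then show ?thesis by (simp add: mean_def)
qed

lemma mean_conv_nth: "mean f xs = (\<Sum>i<length xs. f (xs ! i)) / real (length xs)"
  by (simp add: mean_def sum_list_sum_nth atLeast0LessThan)

lemma hierarchical_mean_mono:
  assumes "\<And>k x. k \<in> J \<Longrightarrow> x \<in> set (zs k) \<Longrightarrow> f x \<le> g x"
  shows "hierarchical_mean J f zs \<le> hierarchical_mean J g zs"
  unfolding hierarchical_mean_def using assms
  by (intro divide_right_mono sum_mono mean_mono) auto

lemma hierarchical_mean_const:
  assumes "finite J" "J \<noteq> {}" "\<And>k. k \<in> J \<Longrightarrow> zs k \<noteq> []"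
  shows "hierarchical_mean J (\<lambda>_. c) zs = c"
  using assms by (simp add: hierarchical_mean_def mean_const)

lemma hierarchical_mean_add:
  "hierarchical_mean J (\<lambda>x. f x + g x) zs = hierarchical_mean J f zs + hierarchical_mean J g zs"
  by (simp add: hierarchical_mean_def mean_add sum.distrib add_divide_distrib)

section \<open>Rank bounds for one realisation of the groups\<close>

definition mass_below :: "nat set \<Rightarrow> ('z \<Rightarrow> real) \<Rightarrow> (nat \<Rightarrow> 'z list) \<Rightarrow> 'z \<Rightarrow> real" where
  "mass_below J s zs z = hierarchical_mean J (\<lambda>x. of_bool (s x < s z)) zs"

text \<open>
  Among the observations of rank at least \<open>p\<close> choose one, \<open>z\<close>, of minimal score. The observations
  scoring below \<open>s z\<close> have total weight at least \<open>p\<close>, and none of them has rank at least \<open>p\<close>.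
\<close>

lemma hierarchical_mean_high_rank_le:
  assumes J: "finite J" "J \<noteq> {}" and ne: "\<And>k. k \<in> J \<Longrightarrow> zs k \<noteq> []" and "p \<le> 1"
  shows "hierarchical_mean J (\<lambda>z. of_bool (p \<le> mass_below J s zs z)) zs \<le> 1 - p"
proof -
  define A where "A = {z \<in> (\<Union>k\<in>J. set (zs k)). p \<le> mass_below J s zs z}"
  have "finite A" using J by (auto simp: A_def)
  show ?thesis
  proof (cases "A = {}")
    case True
    then have "hierarchical_mean J (\<lambda>z. of_bool (p \<le> mass_below J s zs z)) zs
        \<le> hierarchical_mean J (\<lambda>_. 0) zs"
      by (intro hierarchical_mean_mono) (auto simp: A_def)
    then show ?thesis using hierarchical_mean_const[of J zs 0, OF J ne] \<open>p \<le> 1\<close> by simp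
  next
    case False
    then obtain z where z: "z \<in> A" "\<And>x. x \<in> A \<Longrightarrow> s z \<le> s x"
      using \<open>finite A\<close> by (metis arg_min_least arg_min_if_finite(1))
    have "hierarchical_mean J (\<lambda>x. of_bool (p \<le> mass_below J s zs x)) zs + mass_below J s zs z
        = hierarchical_mean J (\<lambda>x. of_bool (p \<le> mass_below J s zs x) + of_bool (s x < s z)) zs"
      by (simp add: hierarchical_mean_add mass_below_def)
    also have "\<dots> \<le> hierarchical_mean J (\<lambda>_. 1) zs"
      using z(2) by (intro hierarchical_mean_mono) (force simp: A_def of_bool_def)
    also have "\<dots> = 1" using hierarchical_mean_const[of J zs 1, OF J ne] by simp
    finally show ?thesis using z(1) by (simp add: A_def)
  qed
qed

text \<open>
  Distinctness leaves at most one observation with score \<open>c\<close>, and no observation weighs more than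
  its whole group. Positions are compared rather than values because the same observation may occur
  repeatedly.
\<close>

lemma hierarchical_mean_level_le:
  assumes J: "finite J"
    and inj: "inj_on (\<lambda>(k, i). s (zs k ! i)) (SIGMA k:J. {..<length (zs k)})"
  shows "hierarchical_mean J (\<lambda>x. of_bool (s x = c)) zs \<le> 1 / real (card J)"
proof -
  let ?D = "SIGMA k:J. {..<length (zs k)}"
  let ?E = "?D \<inter> {x. s (zs (fst x) ! snd x) = c}"
  have fin: "finite ?D" using J by auto
  have "t / real m \<le> t" if "0 \<le> t" for t m
    using that mult_left_mono[of 1 "real m" t] by (cases "m = 0") (simp_all add: divide_le_eq)
  then have "mean (\<lambda>x. of_bool (s x = c)) (zs k) \<le> (\<Sum>i<length (zs k). of_bool (s (zs k ! i) = c))" for k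
    unfolding mean_conv_nth by (simp add: sum_nonneg)
  then have "(\<Sum>k\<in>J. mean (\<lambda>x. of_bool (s x = c)) (zs k))
      \<le> (\<Sum>k\<in>J. \<Sum>i<length (zs k). of_bool (s (zs k ! i) = c))"
    by (intro sum_mono)
  also have "\<dots> = (\<Sum>(k, i)\<in>?D. of_bool (s (zs k ! i) = c))"
    using J by (intro sum.Sigma) auto
  also have "\<dots> = real (card ?E)"
    using fin by (simp add: case_prod_unfold sum_of_bool_eq)
  also have "\<dots> \<le> 1"
  proof -
    have "finite ?E" using fin by blast
    moreover have "\<forall>x\<in>?E. \<forall>y\<in>?E. x = y"
      by (intro ballI inj_onD[OF inj]) auto
    ultimately have "card ?E \<le> Suc 0" by (simp only: card_le_Suc0_iff_eq)
    then show ?thesis by simp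
  qed
  finally show ?thesis
    by (simp add: hierarchical_mean_def divide_right_mono)
qed

text \<open>
  Every observation of rank below \<open>q\<close> scores at most as much as the highest scoring one, \<open>z\<close>. Those
  scoring less than \<open>z\<close> weigh less than \<open>q\<close> by the choice of \<open>z\<close>; ties with \<open>z\<close> account for the
  other summand.
\<close>

lemma hierarchical_mean_low_rank_le:
  assumes J: "finite J" "J \<noteq> {}" and ne: "\<And>k. k \<in> J \<Longrightarrow> zs k \<noteq> []" and "0 \<le> q"
    and inj: "inj_on (\<lambda>(k, i). s (zs k ! i)) (SIGMA k:J. {..<length (zs k)})"
  shows "hierarchical_mean J (\<lambda>z. of_bool (mass_below J s zs z < q)) zs \<le> q + 1 / real (card J)"
proof -
  define A where "A = {z \<in> (\<Union>k\<in>J. set (zs k)). mass_below J s zs z < q}"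
  have "finite A" using J by (auto simp: A_def)
  show ?thesis
  proof (cases "A = {}")
    case True
    then have "hierarchical_mean J (\<lambda>z. of_bool (mass_below J s zs z < q)) zs
        \<le> hierarchical_mean J (\<lambda>_. 0) zs"
      by (intro hierarchical_mean_mono) (auto simp: A_def)
    then show ?thesis using hierarchical_mean_const[of J zs 0, OF J ne] \<open>0 \<le> q\<close>
      by (auto intro: order_trans[OF _ add_nonneg_nonneg])
  next
    case False
    then obtain z where z: "z \<in> A" "\<And>x. x \<in> A \<Longrightarrow> - s z \<le> - s x"
      using \<open>finite A\<close> arg_min_least[of A _ "\<lambda>x. - s x"] arg_min_if_finite(1)[of A "\<lambda>x. - s x"]
      by blast
    have "hierarchical_mean J (\<lambda>x. of_bool (mass_below J s zs x < q)) zs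
        \<le> hierarchical_mean J (\<lambda>x. of_bool (s x < s z) + of_bool (s x = s z)) zs"
      using z(2) by (intro hierarchical_mean_mono) (force simp: A_def of_bool_def)
    also have "\<dots> = mass_below J s zs z + hierarchical_mean J (\<lambda>x. of_bool (s x = s z)) zs"
      by (simp add: hierarchical_mean_add mass_below_def)
    also have "\<dots> \<le> q + 1 / real (card J)"
      using z(1) hierarchical_mean_level_le[OF J(1) inj] by (intro add_mono) (auto simp: A_def)
    finally show ?thesis .
  qed
qed

section \<open>Measurability on the space of nonempty sequences\<close>

text \<open>
  Positions past the end fall back to the first element, which every nonempty sequence has, so that
  \<open>entry i\<close> is measurable on the whole sequence space and not only on the long enough sequences.
\<close>

definition entry :: "nat \<Rightarrow> 'z list \<Rightarrow> 'z" where
  "entry i xs = (if i < length xs then xs ! i else hd xs)"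

lemma in_listset_iff: "xs \<in> listset As \<longleftrightarrow> list_all2 (\<in>) xs As"
  by (induction As arbitrary: xs) (auto simp: set_Cons_def list_all2_Cons2)

lemma seq_space_generators:
  "{listset As | As. As \<noteq> [] \<and> set As \<subseteq> sets M} \<subseteq> Pow {zs \<in> lists (space M). zs \<noteq> []}"
proof -
  have "set As \<subseteq> sets M \<longrightarrow> set xs \<subseteq> space M" if "list_all2 (\<in>) xs As" for xs As
    using that by (induction rule: list_all2_induct) (auto dest: sets.sets_into_space)
  then have "xs \<in> lists (space M) \<and> xs \<noteq> []" if "xs \<in> listset As" "As \<noteq> []" "set As \<subseteq> sets M" for xs As
    using that by (auto simp: in_listset_iff)
  then show ?thesis by blast
qed

lemma space_seq_space: "space (seq_space M) = {zs \<in> lists (space M). zs \<noteq> []}"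
  unfolding seq_space_def by (intro space_measure_of seq_space_generators)

lemma listset_in_seq_space: "As \<noteq> [] \<Longrightarrow> set As \<subseteq> sets M \<Longrightarrow> listset As \<in> sets (seq_space M)"
  unfolding seq_space_def sets_measure_of[OF seq_space_generators] by (intro sigma_sets.Basic) auto

lemma measurable_length_seq_space [measurable]:
  "length \<in> seq_space M \<rightarrow>\<^sub>M count_space UNIV"
proof (rule measurable_count_space_eq2_countable[THEN iffD2, rule_format], intro conjI ballI)
  show "length \<in> space (seq_space M) \<rightarrow> UNIV" by simp
  fix m :: nat
  show "length -` {m} \<inter> space (seq_space M) \<in> sets (seq_space M)"
  proof (cases "m = 0")
    case True
    then have "length -` {m} \<inter> space (seq_space M) = {}" by (auto simp: space_seq_space)
    then show ?thesis by simp
  next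
    case False
    have "list_all2 (\<in>) xs (replicate m (space M)) \<longleftrightarrow> length xs = m \<and> set xs \<subseteq> space M" for xs
      by (auto simp: list_all2_conv_all_nth set_conv_nth)
    with False have "length -` {m} \<inter> space (seq_space M) = listset (replicate m (space M))"
      by (auto simp: space_seq_space in_listset_iff)
    then show ?thesis using False by (auto intro!: listset_in_seq_space)
  qed
qed

lemma measurable_entry [measurable]: "entry i \<in> seq_space M \<rightarrow>\<^sub>M M"
proof (rule measurableI)
  fix xs assume "xs \<in> space (seq_space M)"
  then show "entry i xs \<in> space M"
    by (auto simp: space_seq_space entry_def)
next
  fix A assume A: "A \<in> sets M"
  (* the position that is read in a sequence of length m *)
  define j where "j m = (if i < m then i else 0)" for m
  have *: "entry i xs = xs ! j (length xs)" if "xs \<noteq> []" for xs :: "'a list"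
    using that by (auto simp: entry_def j_def hd_conv_nth)
  have "entry i -` A \<inter> space (seq_space M)
      = (\<Union>m\<in>{1..}. listset ((replicate m (space M))[j m := A]))" (is "?L = ?R")
  proof (intro equalityI subsetI)
    fix xs assume xs: "xs \<in> ?L"
    then have "j (length xs) < length xs" by (auto simp: space_seq_space j_def)
    with xs have "xs \<in> listset ((replicate (length xs) (space M))[j (length xs) := A])" "length xs \<ge> 1"
      by (auto simp: space_seq_space * in_listset_iff list_all2_conv_all_nth nth_list_update Suc_le_eq
          dest: nth_mem)
    then show "xs \<in> ?R" by blast
  next
    fix xs assume "xs \<in> ?R"
    then obtain m where m: "m \<ge> 1" "xs \<in> listset ((replicate m (space M))[j m := A])" by auto
    then have len: "length xs = m" by (auto simp: in_listset_iff list_all2_conv_all_nth)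
    have jm: "j m < m" using m(1) by (auto simp: j_def)
    have "xs ! t \<in> space M" if "t < m" for t
      using m(2) that len jm sets.sets_into_space[OF A]
      by (auto simp: in_listset_iff list_all2_conv_all_nth nth_list_update split: if_splits)
    moreover have "xs ! j m \<in> A"
      using m(2) jm len by (auto simp: in_listset_iff list_all2_conv_all_nth nth_list_update)
    moreover have "xs \<noteq> []" using len m(1) by auto
    ultimately show "xs \<in> ?L"
      using len by (auto simp: space_seq_space * in_set_conv_nth)
  qed
  also have "\<dots> \<in> sets (seq_space M)"
  proof (rule sets.countable_UN''[OF countableI_type])
    fix m :: nat assume "m \<in> {1..}"
    then have "(replicate m (space M))[j m := A] \<noteq> []" by auto
    moreover have "set ((replicate m (space M))[j m := A]) \<subseteq> sets M"
      by (rule order_trans[OF set_update_subset_insert]) (use A in auto)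
    ultimately show "listset ((replicate m (space M))[j m := A]) \<in> sets (seq_space M)"
      by (rule listset_in_seq_space)
  qed
  finally show "entry i -` A \<inter> space (seq_space M) \<in> sets (seq_space M)" .
qed

lemma measurable_hd_seq_space [measurable]: "hd \<in> seq_space M \<rightarrow>\<^sub>M M"
proof -
  have "entry 0 \<in> seq_space M \<rightarrow>\<^sub>M M" by simp
  also have "?this \<longleftrightarrow> ?thesis"
    by (intro measurable_cong) (auto simp: space_seq_space entry_def hd_conv_nth)
  finally show ?thesis .
qed

text \<open>
  A random sequence has a random number of terms; since lengths are countable, it suffices to treat
  the sum for each fixed length.
\<close>

lemma borel_measurable_mean:
  assumes N: "g \<in> N \<rightarrow>\<^sub>M seq_space M"
    and f: "(\<lambda>(x, z). f x z) \<in> borel_measurable (N \<Otimes>\<^sub>M M)"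
  shows "(\<lambda>x. mean (f x) (g x)) \<in> borel_measurable N"
proof -
  note [measurable] = N
  have fi [measurable]: "(\<lambda>x. f x (entry i (g x))) \<in> borel_measurable N" for i
    using measurable_compose[OF measurable_Pair[OF measurable_ident_sets[OF refl] measurable_compose[OF N measurable_entry]] f]
    by simp
  have "(\<lambda>x. (\<lambda>m x. (\<Sum>i<m. f x (entry i (g x))) / real m) (length (g x)) x) \<in> borel_measurable N"
    by (rule measurable_compose_countable) measurable
  also have "(\<lambda>x. (\<lambda>m x. (\<Sum>i<m. f x (entry i (g x))) / real m) (length (g x)) x)
      = (\<lambda>x. mean (f x) (g x))"
    by (auto simp: mean_conv_nth entry_def fun_eq_iff intro!: arg_cong2[where f = "(/)"] sum.cong)
  finally show ?thesis .
qed

section \<open>Exchanging the test point with the other observations\<close>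

locale hierarchical_sample = prob_space P for P :: "'w measure" +
  fixes M :: "'z measure" and n :: nat and Z :: "nat \<Rightarrow> 'w \<Rightarrow> 'z list"
  assumes measurable_group: "\<And>k. k \<in> {1..n} \<Longrightarrow> Z k \<in> P \<rightarrow>\<^sub>M seq_space M"
    and exchangeable: "hierarchically_exchangeable P M n Z"
begin

abbreviation group_space :: "(nat \<Rightarrow> 'z list) measure" where
  "group_space \<equiv> \<Pi>\<^sub>M j\<in>{1..n}. seq_space M"

definition sample :: "'w \<Rightarrow> nat \<Rightarrow> 'z list" where
  "sample \<omega> = (\<lambda>j\<in>{1..n}. Z j \<omega>)"

lemma measurable_sample [measurable]: "sample \<in> P \<rightarrow>\<^sub>M group_space"
  unfolding sample_def by (intro measurable_restrict measurable_group)

lemma measurable_sample_group [measurable]: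
  assumes "k \<in> {1..n}"
  shows "(\<lambda>\<omega>. sample \<omega> k) \<in> P \<rightarrow>\<^sub>M seq_space M"
  using measurable_compose[OF measurable_sample measurable_component_singleton[OF assms]] .

lemma sample_nonempty: "\<omega> \<in> space P \<Longrightarrow> k \<in> {1..n} \<Longrightarrow> sample \<omega> k \<noteq> []"
  using measurable_space[OF measurable_sample_group] by (auto simp: space_seq_space)

lemma pred_at_entry:
  assumes k: "k \<in> {1..n}" and h: "h \<in> seq_space M \<rightarrow>\<^sub>M M"
    and e: "Measurable.pred (group_space \<Otimes>\<^sub>M M) (\<lambda>(zs, z). e zs z)"
  shows "Measurable.pred group_space (\<lambda>zs. e zs (h (zs k)))"
  using measurable_compose[OF measurable_Pair[OF measurable_ident_sets[OF refl]
      measurable_compose[OF measurable_component_singleton[OF k] h]] e]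
  by simp

text \<open>
  Exchangeability within group \<open>k\<close>, applied to the transposition of positions \<open>0\<close> and \<open>i\<close>: it brings
  the \<open>i\<close>-th entry to the front and leaves the event otherwise alone, because \<open>e\<close> ignores the order
  inside the group.
\<close>

lemma prob_entry_eq:
  assumes k: "k \<in> {1..n}" and i: "i < m"
    and e: "Measurable.pred (group_space \<Otimes>\<^sub>M M) (\<lambda>(zs, z). e zs z)"
    and inv: "\<And>zs \<sigma> z. zs \<in> space group_space \<Longrightarrow> \<sigma> permutes {..<length (zs k)} \<Longrightarrow>
      e (zs(k := permute_list \<sigma> (zs k))) z = e zs z"
  shows "\<P>(\<omega> in P. e (sample \<omega>) (entry i (sample \<omega> k)) \<and> length (sample \<omega> k) = m) =
    \<P>(\<omega> in P. e (sample \<omega>) (hd (sample \<omega> k)) \<and> length (sample \<omega> k) = m)" (is "?p = ?q")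
proof (cases "\<P>(\<omega> in P. length (sample \<omega> k) = m) = 0")
  note [measurable] = measurable_sample_group[OF k]
  case True
  have "?p \<le> \<P>(\<omega> in P. length (sample \<omega> k) = m)"
    by (rule finite_measure_mono) auto
  moreover have "?q \<le> \<P>(\<omega> in P. length (sample \<omega> k) = m)"
    by (rule finite_measure_mono) auto
  ultimately show ?thesis using True by (simp add: measure_le_0_iff)
next
  case False
  have Zk: "Z k \<omega> = sample \<omega> k" for \<omega> using k by (simp add: sample_def)
  have pos: "\<P>(\<omega> in P. length (Z k \<omega>) = m) > 0"
    using False unfolding Zk by (rule zero_less_measure_iff[THEN iffD2])
  define \<sigma> where "\<sigma> = Transposition.transpose 0 i"
  have \<sigma>: "\<sigma> permutes {..<m}" unfolding \<sigma>_def using i by (intro permutes_swap_id) auto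
  (* The preimage of B under the rearranged sample is identified outcome by outcome, which avoids
     proving that permuting a sequence is measurable. *)
  define B where "B = {zs \<in> space group_space. e zs (hd (zs k))}"
  have "Measurable.pred group_space (\<lambda>zs. e zs (hd (zs k)))"
    by (intro pred_at_entry[OF k _ e]) simp
  then have B: "B \<in> sets group_space" by (simp add: B_def pred_def)
  let ?swap = "\<lambda>\<omega>. \<lambda>j\<in>{1..n}. if j = k then permute_list \<sigma> (Z k \<omega>) else Z j \<omega>"
  have swap: "?swap \<omega> = (sample \<omega>)(k := permute_list \<sigma> (sample \<omega> k))" for \<omega>
    using k by (auto simp: sample_def fun_eq_iff)
  have iff: "?swap \<omega> \<in> B \<longleftrightarrow> e (sample \<omega>) (entry i (sample \<omega> k))"
    if \<omega>: "\<omega> \<in> space P" and len: "length (sample \<omega> k) = m" for \<omega>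
  proof -
    have sp: "sample \<omega> \<in> space group_space" using measurable_space[OF measurable_sample \<omega>] .
    have "sample \<omega> k \<in> space (seq_space M)" using measurable_space[OF measurable_sample_group[OF k] \<omega>] .
    then have "permute_list \<sigma> (sample \<omega> k) \<in> space (seq_space M)"
      using \<sigma> len set_permute_list[of \<sigma> "sample \<omega> k"]
      by (auto simp: space_seq_space simp flip: set_empty)
    with sp k have "?swap \<omega> \<in> space group_space"
      unfolding swap by (auto simp: space_PiM PiE_iff extensional_def)
    moreover have "hd (permute_list \<sigma> (sample \<omega> k)) = entry i (sample \<omega> k)"
      using i len \<sigma> sample_nonempty[OF \<omega> k]
      by (subst hd_conv_nth) (auto simp: permute_list_nth entry_def \<sigma>_def simp flip: length_0_conv)
    ultimately show ?thesis
      using inv[OF sp] \<sigma> len unfolding B_def swap by simp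
  qed
  have "\<P>(\<omega> in P. sample \<omega> \<in> B \<bar> length (Z k \<omega>) = m) = \<P>(\<omega> in P. ?swap \<omega> \<in> B \<bar> length (Z k \<omega>) = m)"
    using exchangeable[unfolded hierarchically_exchangeable_def, THEN conjunct2, rule_format,
        OF k _ pos \<sigma> B] i
    unfolding sample_def by (simp add: Suc_le_eq)
  then have "\<P>(\<omega> in P. sample \<omega> \<in> B \<and> length (Z k \<omega>) = m) = \<P>(\<omega> in P. ?swap \<omega> \<in> B \<and> length (Z k \<omega>) = m)"
    using pos by (simp add: cond_prob_def)
  also have "{\<omega> \<in> space P. sample \<omega> \<in> B \<and> length (Z k \<omega>) = m}
      = {\<omega> \<in> space P. e (sample \<omega>) (hd (sample \<omega> k)) \<and> length (sample \<omega> k) = m}"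
    using measurable_space[OF measurable_sample] by (auto simp: B_def Zk)
  also have "{\<omega> \<in> space P. ?swap \<omega> \<in> B \<and> length (Z k \<omega>) = m}
      = {\<omega> \<in> space P. e (sample \<omega>) (entry i (sample \<omega> k)) \<and> length (sample \<omega> k) = m}"
    using iff by (auto simp only: Zk)
  finally show ?thesis by simp
qed

text \<open>
  On the event that group \<open>k\<close> has length \<open>m\<close>, all \<open>m\<close> entries are equally likely to satisfy \<open>e\<close>, so
  the first one may be replaced by the average of all of them. The events for different \<open>m\<close> partition
  the probability space.
\<close>

lemma prob_hd_eq_expectation_mean:
  assumes k: "k \<in> {1..n}"
    and e: "Measurable.pred (group_space \<Otimes>\<^sub>M M) (\<lambda>(zs, z). e zs z)"
    and inv: "\<And>zs \<sigma> z. zs \<in> space group_space \<Longrightarrow> \<sigma> permutes {..<length (zs k)} \<Longrightarrow>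
      e (zs(k := permute_list \<sigma> (zs k))) z = e zs z"
  shows "\<P>(\<omega> in P. e (sample \<omega>) (hd (sample \<omega> k))) =
      expectation (\<lambda>\<omega>. mean (\<lambda>z. of_bool (e (sample \<omega>) z)) (sample \<omega> k))"
    and "integrable P (\<lambda>\<omega>. mean (\<lambda>z. of_bool (e (sample \<omega>) z)) (sample \<omega> k))"
proof -
  note [measurable] = measurable_sample_group[OF k]
  let ?f = "\<lambda>\<omega>. of_bool (e (sample \<omega>) (hd (sample \<omega> k))) :: real"
  let ?g = "\<lambda>\<omega>. mean (\<lambda>z. of_bool (e (sample \<omega>) z)) (sample \<omega> k)"
  define A where "A m = {\<omega> \<in> space P. length (sample \<omega> k) = m}" for m
  have A [measurable]: "A m \<in> sets P" for m unfolding A_def by measurable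
  have pred [measurable]: "Measurable.pred P (\<lambda>\<omega>. e (sample \<omega>) (h (sample \<omega> k)))"
    if "h \<in> seq_space M \<rightarrow>\<^sub>M M" for h
    using measurable_compose[OF measurable_sample pred_at_entry[OF k that e]] .
  have pred_hd [measurable]: "Measurable.pred P (\<lambda>\<omega>. e (sample \<omega>) (hd (sample \<omega> k)))"
    and pred_entry [measurable]: "Measurable.pred P (\<lambda>\<omega>. e (sample \<omega>) (entry i (sample \<omega> k)))" for i
    by (intro pred; measurable)+
  have f: "integrable P ?f"
    by (intro integrable_const_bound[of _ 1]) auto
  have "(\<lambda>zs. mean (\<lambda>z. of_bool (e zs z) :: real) (zs k)) \<in> borel_measurable group_space"
    using e by (intro borel_measurable_mean[OF measurable_component_singleton[OF k]])
      (simp add: case_prod_unfold)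
  from measurable_compose[OF measurable_sample this] show g: "integrable P ?g"
    using mean_bounds[OF sample_nonempty[OF _ k]]
    by (intro integrable_const_bound[of _ 1]) (auto simp: abs_le_iff intro!: AE_I2 order_trans[of _ 0])
  have UA: "(\<Union>m. A m) = space P" by (auto simp: A_def)
  have split: "expectation h = (\<Sum>m. set_lebesgue_integral P (A m) h)"
    if "integrable P h" for h :: "'w \<Rightarrow> real"
  proof -
    have "expectation h = set_lebesgue_integral P (\<Union>m. A m) h"
      unfolding UA using that by (simp add: set_integral_space)
    also have "\<dots> = (\<Sum>m. set_lebesgue_integral P (A m) h)"
    proof (rule lebesgue_integral_countable_add)
      show "set_integrable P (\<Union>m. A m) h"
        unfolding UA set_integrable_def using that by (intro integrable_mult_indicator) auto
    qed (auto simp: A_def)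
    finally show ?thesis .
  qed
  have "set_lebesgue_integral P (A m) ?f = set_lebesgue_integral P (A m) ?g" for m
  proof -
    have ind: "expectation (\<lambda>\<omega>. indicator (A m) \<omega> * of_bool (e (sample \<omega>) (h (sample \<omega> k))) :: real) =
        \<P>(\<omega> in P. e (sample \<omega>) (h (sample \<omega> k)) \<and> length (sample \<omega> k) = m)"
      if "h \<in> seq_space M \<rightarrow>\<^sub>M M" for h
    proof -
      have "expectation (\<lambda>\<omega>. indicator (A m) \<omega> * of_bool (e (sample \<omega>) (h (sample \<omega> k))) :: real)
        = expectation (indicator {\<omega> \<in> space P. e (sample \<omega>) (h (sample \<omega> k)) \<and> length (sample \<omega> k) = m})"
        by (intro Bochner_Integration.integral_cong) (auto simp: A_def indicator_def)
      then show ?thesis using pred[OF that] by simp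
    qed
    have "set_lebesgue_integral P (A m) ?g = expectation (\<lambda>\<omega>. (\<Sum>i<m.
        indicator (A m) \<omega> * of_bool (e (sample \<omega>) (entry i (sample \<omega> k)))) / real m)"
      unfolding set_lebesgue_integral_def
      by (intro Bochner_Integration.integral_cong refl)
        (auto simp: A_def indicator_def mean_conv_nth entry_def simp del: sum_of_bool_eq
          intro!: arg_cong2[where f = "(/)"] sum.cong)
    also have "\<dots> = (\<Sum>i<m. \<P>(\<omega> in P. e (sample \<omega>) (entry i (sample \<omega> k)) \<and> length (sample \<omega> k) = m)) / real m"
      using ind[OF measurable_entry]
      by (subst Bochner_Integration.integral_divide_zero, subst Bochner_Integration.integral_sum)
        (auto intro!: integrable_const_bound[of _ 1] simp: indicator_def)
    also have "\<dots> = (\<Sum>i<m. \<P>(\<omega> in P. e (sample \<omega>) (hd (sample \<omega> k)) \<and> length (sample \<omega> k) = m)) / real m"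
      using prob_entry_eq[OF k _ e inv] by simp
    also have "\<dots> = \<P>(\<omega> in P. e (sample \<omega>) (hd (sample \<omega> k)) \<and> length (sample \<omega> k) = m)"
    proof (cases "m = 0")
      case True
      then have "{\<omega> \<in> space P. e (sample \<omega>) (hd (sample \<omega> k)) \<and> length (sample \<omega> k) = m} = {}"
        using sample_nonempty[OF _ k] by auto
      then show ?thesis using True by (metis measure_empty sum.empty lessThan_0 div_0)
    qed simp
    also have "\<dots> = set_lebesgue_integral P (A m) ?f"
      unfolding set_lebesgue_integral_def using ind[OF measurable_hd_seq_space] by simp
    finally show ?thesis by simp
  qed
  then have "expectation ?f = expectation ?g"
    using split[OF f] split[OF g] by simp
  moreover have "expectation ?f = expectation (indicator {\<omega> \<in> space P. e (sample \<omega>) (hd (sample \<omega> k))})"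
    by (intro Bochner_Integration.integral_cong) (auto simp: indicator_def)
  ultimately show "\<P>(\<omega> in P. e (sample \<omega>) (hd (sample \<omega> k))) = expectation ?g"
    by simp
qed

text \<open>
  Exchangeability of the groups, applied to the transposition of \<open>k\<close> and \<open>l\<close>. Only this
  transposition has to preserve \<open>e\<close>; in the application \<open>e\<close> is not invariant under moving the training
  groups.
\<close>

lemma prob_hd_group_eq:
  assumes k: "k \<in> {1..n}" and l: "l \<in> {1..n}"
    and e: "Measurable.pred (group_space \<Otimes>\<^sub>M M) (\<lambda>(zs, z). e zs z)"
    and inv: "\<And>zs z. zs \<in> space group_space \<Longrightarrow>
      e (\<lambda>j\<in>{1..n}. zs (Transposition.transpose k l j)) z = e zs z"
  shows "\<P>(\<omega> in P. e (sample \<omega>) (hd (sample \<omega> l))) = \<P>(\<omega> in P. e (sample \<omega>) (hd (sample \<omega> k)))"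
proof -
  let ?\<sigma> = "Transposition.transpose k l"
  have \<sigma>: "?\<sigma> permutes {1..n}" using k l by (intro permutes_swap_id)
  define B where "B = {zs \<in> space group_space. e zs (hd (zs l))}"
  have "Measurable.pred group_space (\<lambda>zs. e zs (hd (zs l)))"
    by (intro pred_at_entry[OF l _ e]) simp
  then have B: "B \<in> sets group_space" by (simp add: B_def pred_def)
  let ?swap = "\<lambda>\<omega>. \<lambda>j\<in>{1..n}. Z (?\<sigma> j) \<omega>"
  have swap_meas: "?swap \<in> P \<rightarrow>\<^sub>M group_space"
    using permutes_in_image[OF \<sigma>] by (intro measurable_restrict measurable_group) auto
  have swap: "?swap \<omega> = (\<lambda>j\<in>{1..n}. sample \<omega> (?\<sigma> j))" for \<omega>
    using permutes_in_image[OF \<sigma>] by (auto simp: sample_def fun_eq_iff)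
  have "distr P group_space sample = distr P group_space ?swap"
    using exchangeable \<sigma> unfolding hierarchically_exchangeable_def sample_def[abs_def] by blast
  then have "measure (distr P group_space sample) B = measure (distr P group_space ?swap) B" by simp
  then have "prob (sample -` B \<inter> space P) = prob (?swap -` B \<inter> space P)"
    unfolding measure_distr[OF measurable_sample B] measure_distr[OF swap_meas B] .
  also have "sample -` B \<inter> space P = {\<omega> \<in> space P. e (sample \<omega>) (hd (sample \<omega> l))}"
    using measurable_space[OF measurable_sample] by (auto simp: B_def)
  also have "?swap -` B \<inter> space P = {\<omega> \<in> space P. e (sample \<omega>) (hd (sample \<omega> k))}"
  proof -
    have "?swap \<omega> \<in> B \<longleftrightarrow> e (sample \<omega>) (hd (sample \<omega> k))" if \<omega>: "\<omega> \<in> space P" for \<omega>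
    proof -
      have "?swap \<omega> l = sample \<omega> k" using l unfolding swap by simp
      then show ?thesis
        using measurable_space[OF swap_meas \<omega>] inv[OF measurable_space[OF measurable_sample \<omega>]]
        unfolding B_def swap by simp
    qed
    then show ?thesis by auto
  qed
  finally show ?thesis .
qed

text \<open>
  The first observation of group \<open>l\<close> is as good as a randomly drawn observation: draw a group of \<open>J\<close>
  uniformly and then an entry of it uniformly. All groups of \<open>J\<close> give the same probability, and within
  each group it is the expected proportion of entries satisfying \<open>e\<close>.
\<close>

lemma prob_hd_eq_expectation_hierarchical_mean:
  assumes J: "J \<subseteq> {1..n}" and l: "l \<in> J"
    and e: "Measurable.pred (group_space \<Otimes>\<^sub>M M) (\<lambda>(zs, z). e zs z)"
    and swap_groups: "\<And>zs z k. zs \<in> space group_space \<Longrightarrow> k \<in> J \<Longrightarrow>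
      e (\<lambda>j\<in>{1..n}. zs (Transposition.transpose k l j)) z = e zs z"
    and permute_group: "\<And>zs \<sigma> z k. zs \<in> space group_space \<Longrightarrow> k \<in> J \<Longrightarrow>
      \<sigma> permutes {..<length (zs k)} \<Longrightarrow> e (zs(k := permute_list \<sigma> (zs k))) z = e zs z"
  shows "\<P>(\<omega> in P. e (sample \<omega>) (hd (sample \<omega> l))) =
      expectation (\<lambda>\<omega>. hierarchical_mean J (\<lambda>z. of_bool (e (sample \<omega>) z)) (sample \<omega>))"
    and "integrable P (\<lambda>\<omega>. hierarchical_mean J (\<lambda>z. of_bool (e (sample \<omega>) z)) (sample \<omega>))"
proof -
  let ?m = "\<lambda>k \<omega>. mean (\<lambda>z. of_bool (e (sample \<omega>) z)) (sample \<omega> k)"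
  have int: "integrable P (?m k)" if "k \<in> J" for k
    by (rule prob_hd_eq_expectation_mean(2)[where k = k, OF _ e permute_group[OF _ that]])
      (use that J in auto)
  then show "integrable P (\<lambda>\<omega>. hierarchical_mean J (\<lambda>z. of_bool (e (sample \<omega>) z)) (sample \<omega>))"
    unfolding hierarchical_mean_def by (intro integrable_divide integrable_sum) auto
  have "finite J" by (rule finite_subset[OF J]) simp
  then have "real (card J) \<noteq> 0" using l by auto
  have *: "\<P>(\<omega> in P. e (sample \<omega>) (hd (sample \<omega> l))) = expectation (?m k)" if "k \<in> J" for k
  proof -
    have kl: "k \<in> {1..n}" "l \<in> {1..n}" using that J l by auto
    show ?thesis
      by (rule trans[OF prob_hd_group_eq[where k = k and l = l, OF kl e swap_groups[OF _ that]]
            prob_hd_eq_expectation_mean(1)[where k = k, OF kl(1) e permute_group[OF _ that]]])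
  qed
  have "expectation (\<lambda>\<omega>. hierarchical_mean J (\<lambda>z. of_bool (e (sample \<omega>) z)) (sample \<omega>))
      = (\<Sum>k\<in>J. expectation (?m k)) / real (card J)"
    unfolding hierarchical_mean_def integral_divide_zero
    by (subst Bochner_Integration.integral_sum) (use int in auto)
  also have "(\<Sum>k\<in>J. expectation (?m k)) = (\<Sum>k\<in>J. \<P>(\<omega> in P. e (sample \<omega>) (hd (sample \<omega> l))))"
    by (rule sum.cong[OF refl *[symmetric]])
  finally show "\<P>(\<omega> in P. e (sample \<omega>) (hd (sample \<omega> l))) =
      expectation (\<lambda>\<omega>. hierarchical_mean J (\<lambda>z. of_bool (e (sample \<omega>) z)) (sample \<omega>))"
    using \<open>real (card J) \<noteq> 0\<close> by simp
qed

end

section \<open>The conformal threshold as a rank condition\<close>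

lemma measure_calibration_dist_atMost:
  "measure (calibration_dist K\<^sub>0 K\<^sub>1 s zs) {..ereal t} =
    (\<Sum>k = K\<^sub>0 + 1..K\<^sub>0 + K\<^sub>1. mean (\<lambda>z. of_bool (s z \<le> t)) (zs k)) / (real K\<^sub>1 + 1)"
proof -
  have "emeasure (calibration_dist K\<^sub>0 K\<^sub>1 s zs) {..ereal t} =
      (\<Sum>k = K\<^sub>0 + 1..K\<^sub>0 + K\<^sub>1. \<Sum>i<length (zs k).
        ennreal (of_bool (s (zs k ! i) \<le> t) / ((real K\<^sub>1 + 1) * real (length (zs k)))))"
  proof -
    have "ennreal (1 / d) * emeasure (return borel (ereal x)) {..ereal t} = ennreal (of_bool (x \<le> t) / d)"
      for d x by (simp add: emeasure_return indicator_def)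
    moreover have "emeasure (return borel \<infinity>) {..ereal t} = 0"
      by (simp add: emeasure_return)
    ultimately show ?thesis
      by (subst emeasure_calibration_dist) (simp_all only: borel_closed closed_atMost mult_zero_right add_0_right)
  qed
  also have "\<dots> = ennreal (\<Sum>k = K\<^sub>0 + 1..K\<^sub>0 + K\<^sub>1. \<Sum>i<length (zs k).
        of_bool (s (zs k ! i) \<le> t) / ((real K\<^sub>1 + 1) * real (length (zs k))))"
    by (simp add: sum_nonneg sum_ennreal del: sum_of_bool_eq)
  also have "(\<Sum>k = K\<^sub>0 + 1..K\<^sub>0 + K\<^sub>1. \<Sum>i<length (zs k).
        of_bool (s (zs k ! i) \<le> t) / ((real K\<^sub>1 + 1) * real (length (zs k)))) =
      (\<Sum>k = K\<^sub>0 + 1..K\<^sub>0 + K\<^sub>1. mean (\<lambda>z. of_bool (s z \<le> t)) (zs k)) / (real K\<^sub>1 + 1)"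
    unfolding mean_conv_nth sum_divide_distrib by (simp only: divide_divide_eq_left mult.commute)
  finally show ?thesis
    by (rule measure_eq_emeasure_eq_ennreal[rotated])
      (intro divide_nonneg_nonneg sum_nonneg; simp add: mean_conv_nth)
qed

text \<open>
  The distribution function is a step function with finitely many steps, so its left limit at \<open>x\<close> is
  already attained at some \<open>t < x\<close>, and the infimum defining the quantile is less than \<open>x\<close> exactly when
  this left limit reaches \<open>p\<close>. The point mass at \<open>\<infinity>\<close> never contributes below a real threshold.
\<close>

lemma le_quantile_calibration_dist_iff:
  "ereal x \<le> quantile p (calibration_dist K\<^sub>0 K\<^sub>1 s zs) \<longleftrightarrow>
    (\<Sum>k = K\<^sub>0 + 1..K\<^sub>0 + K\<^sub>1. mean (\<lambda>z. of_bool (s z < x)) (zs k)) / (real K\<^sub>1 + 1) < p"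
    (is "_ \<longleftrightarrow> ?below < p")
proof -
  let ?F = "\<lambda>t. measure (calibration_dist K\<^sub>0 K\<^sub>1 s zs) {..ereal t}"
  have F_le: "?F t \<le> ?below" if "t < x" for t
    unfolding measure_calibration_dist_atMost
    using that by (intro divide_right_mono sum_mono mean_mono) auto
  define A where "A = {u \<in> (\<Union>k\<in>{K\<^sub>0 + 1..K\<^sub>0 + K\<^sub>1}. s ` set (zs k)). u < x}"
  (* no score lies strictly between t and x; x - 1 covers the case of no score below x *)
  define t where "t = Max (insert (x - 1) A)"
  have "finite A" by (simp add: A_def)
  then have t: "t < x" "\<And>u. u \<in> A \<Longrightarrow> u \<le> t"
    by (auto simp: t_def A_def)
  have "s z \<le> t" if "k \<in> {K\<^sub>0 + 1..K\<^sub>0 + K\<^sub>1}" "z \<in> set (zs k)" "s z < x" for k z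
    using that by (intro t(2)) (auto simp: A_def)
  then have F_ge: "?below \<le> ?F t"
    unfolding measure_calibration_dist_atMost
    by (intro divide_right_mono sum_mono mean_mono) auto
  have "ereal x \<le> quantile p (calibration_dist K\<^sub>0 K\<^sub>1 s zs) \<longleftrightarrow> (\<forall>u. p \<le> ?F u \<longrightarrow> x \<le> u)"
    by (auto simp: quantile_def le_Inf_iff)
  also have "\<dots> \<longleftrightarrow> ?below < p"
    using F_le F_ge t(1) by (meson leD leI order_trans)
  finally show ?thesis .
qed

lemma mem_hcp_set_iff:
  fixes S :: "(nat \<Rightarrow> ('x \<times> 'y) list) \<Rightarrow> 'x \<times> 'y \<Rightarrow> real"
    and zs :: "nat \<Rightarrow> ('x \<times> 'y) list" and K\<^sub>0 :: nat
  assumes "y \<in> space Y"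
  defines "s \<equiv> S (\<lambda>k\<in>{1..K\<^sub>0}. zs k)"
  shows "y \<in> hcp_set Y K\<^sub>0 K\<^sub>1 \<alpha> S zs x \<longleftrightarrow>
    (\<Sum>k = K\<^sub>0 + 1..K\<^sub>0 + K\<^sub>1. mean (\<lambda>z. of_bool (s z < s (x, y))) (zs k)) / (real K\<^sub>1 + 1) < 1 - \<alpha>"
  using assms by (simp add: hcp_set_def Let_def le_quantile_calibration_dist_iff)

section \<open>Symmetry of the rank of an observation\<close>

definition trained_mass_below ::
    "nat \<Rightarrow> nat set \<Rightarrow> ((nat \<Rightarrow> 'z list) \<Rightarrow> 'z \<Rightarrow> real) \<Rightarrow> (nat \<Rightarrow> 'z list) \<Rightarrow> 'z \<Rightarrow> real" where
  "trained_mass_below K\<^sub>0 J S zs = mass_below J (S (\<lambda>k\<in>{1..K\<^sub>0}. zs k)) zs"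

lemma borel_measurable_trained_mean:
  fixes S :: "(nat \<Rightarrow> 'z list) \<Rightarrow> 'z \<Rightarrow> real" and K\<^sub>0 :: nat
  assumes k: "k \<in> {1..n}" and "K\<^sub>0 \<le> n"
    and S: "(\<lambda>(d, z). S d z) \<in> (\<Pi>\<^sub>M k\<in>{1..K\<^sub>0}. seq_space M) \<Otimes>\<^sub>M M \<rightarrow>\<^sub>M borel"
  defines "s \<equiv> \<lambda>zs. S (\<lambda>k\<in>{1..K\<^sub>0}. zs k)"
  shows "(\<lambda>(zs, z). mean (\<lambda>x. of_bool (s zs x < s zs z)) (zs k)) \<in>
    borel_measurable ((\<Pi>\<^sub>M k\<in>{1..n}. seq_space M) \<Otimes>\<^sub>M M)"
proof -
  let ?L = "\<Pi>\<^sub>M k\<in>{1..n}. seq_space M"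
  have train [measurable]: "(\<lambda>zs. \<lambda>k\<in>{1..K\<^sub>0}. zs k) \<in> ?L \<rightarrow>\<^sub>M (\<Pi>\<^sub>M k\<in>{1..K\<^sub>0}. seq_space M)"
    using \<open>K\<^sub>0 \<le> n\<close> by (intro measurable_restrict measurable_component_singleton) auto
  have s: "(\<lambda>w. s (f w) (g w)) \<in> borel_measurable N"
    if [measurable]: "f \<in> N \<rightarrow>\<^sub>M ?L" "g \<in> N \<rightarrow>\<^sub>M M" for N :: "'b measure" and f g
  proof -
    have "(\<lambda>w. (\<lambda>k\<in>{1..K\<^sub>0}. f w k, g w)) \<in> N \<rightarrow>\<^sub>M (\<Pi>\<^sub>M k\<in>{1..K\<^sub>0}. seq_space M) \<Otimes>\<^sub>M M"
      by (intro measurable_Pair measurable_compose[OF that(1) train] that(2))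
    from measurable_compose[OF this S] show ?thesis by (simp add: s_def)
  qed
  let ?N = "(?L \<Otimes>\<^sub>M M) \<Otimes>\<^sub>M M"
  have "(\<lambda>w. s (fst (fst w)) (snd w)) \<in> borel_measurable ?N"
    "(\<lambda>w. s (fst (fst w)) (snd (fst w))) \<in> borel_measurable ?N"
    by (intro s; measurable)+
  then have "Measurable.pred ?N (\<lambda>w. s (fst (fst w)) (snd w) < s (fst (fst w)) (snd (fst w)))"
    by measurable
  then have "(\<lambda>w. of_bool (s (fst (fst w)) (snd w) < s (fst (fst w)) (snd (fst w))) :: real)
      \<in> borel_measurable ?N"
    by measurable
  then have "(\<lambda>w. mean (\<lambda>x. of_bool (s (fst w) x < s (fst w) (snd w))) (fst w k))
      \<in> borel_measurable (?L \<Otimes>\<^sub>M M)"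
    using k by (intro borel_measurable_mean[of _ _ M])
      (auto simp: case_prod_unfold intro: measurable_compose[OF measurable_fst measurable_component_singleton])
  then show ?thesis by (simp add: case_prod_unfold)
qed

text \<open>
  Swapping two groups outside the training range leaves the learned score function as it is and only
  reorders the sum over \<open>J\<close>.
\<close>

lemma trained_mass_below_swap_groups:
  assumes J: "J \<subseteq> {K\<^sub>0 + 1..n}" and kl: "k \<in> J" "l \<in> J"
  shows "trained_mass_below K\<^sub>0 J S (\<lambda>j\<in>{1..n}. zs (Transposition.transpose k l j)) =
    trained_mass_below K\<^sub>0 J S zs"
proof -
  let ?\<sigma> = "Transposition.transpose k l"
  let ?zs = "\<lambda>j\<in>{1..n}. zs (?\<sigma> j)"
  have perm: "?\<sigma> permutes J" using kl by (rule permutes_swap_id)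
  have "K\<^sub>0 < k" "K\<^sub>0 < l" "K\<^sub>0 \<le> n" using J kl by auto
  then have train: "(\<lambda>j\<in>{1..K\<^sub>0}. ?zs j) = (\<lambda>j\<in>{1..K\<^sub>0}. zs j)"
    by (auto simp: fun_eq_iff Transposition.transpose_def)
  have "(\<Sum>j\<in>J. mean f (?zs j)) = (\<Sum>j\<in>J. mean f (zs j))" for f
  proof -
    have "(\<Sum>j\<in>J. mean f (?zs j)) = (\<Sum>j\<in>J. mean f (zs (?\<sigma> j)))"
      using J by (intro sum.cong) auto
    also have "\<dots> = (\<Sum>j\<in>J. mean f (zs j))"
      using sum.permute[OF perm, of "\<lambda>j. mean f (zs j)"] by (simp add: comp_def)
    finally show ?thesis .
  qed
  then show ?thesis
    unfolding trained_mass_below_def train mass_below_def hierarchical_mean_def by simp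
qed

lemma trained_mass_below_permute_group:
  assumes J: "J \<subseteq> {K\<^sub>0 + 1..n}" and k: "k \<in> J" and \<sigma>: "\<sigma> permutes {..<length (zs k)}"
  shows "trained_mass_below K\<^sub>0 J S (zs(k := permute_list \<sigma> (zs k))) = trained_mass_below K\<^sub>0 J S zs"
proof -
  have train: "(\<lambda>j\<in>{1..K\<^sub>0}. (zs(k := permute_list \<sigma> (zs k))) j) = (\<lambda>j\<in>{1..K\<^sub>0}. zs j)"
    using J k by (auto simp: fun_eq_iff)
  have "mean f ((zs(k := permute_list \<sigma> (zs k))) j) = mean f (zs j)" for f j
    using mean_permute_list[OF \<sigma>] by simp
  then show ?thesis
    unfolding trained_mass_below_def train mass_below_def hierarchical_mean_def by simp
qed

section \<open>Coverage\<close>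

theorem theorem1:
  fixes P :: "'w measure" and X :: "'x measure" and Y :: "'y measure"
    and Z :: "nat \<Rightarrow> 'w \<Rightarrow> ('x \<times> 'y) list"
    and S :: "(nat \<Rightarrow> ('x \<times> 'y) list) \<Rightarrow> 'x \<times> 'y \<Rightarrow> real"
    and \<alpha> :: real and K K\<^sub>0 K\<^sub>1 :: nat
  assumes "0 < \<alpha>" and "\<alpha> < 1"
    and "K = K\<^sub>0 + K\<^sub>1" and "K\<^sub>0 \<ge> 1" and "K\<^sub>1 \<ge> 1"
    and "prob_space P"
    and "\<And>k. k \<in> {1..K + 1} \<Longrightarrow> Z k \<in> P \<rightarrow>\<^sub>M seq_space (X \<Otimes>\<^sub>M Y)"
    and "hierarchically_exchangeable P (X \<Otimes>\<^sub>M Y) (K + 1) Z"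
    and "(\<lambda>(d, z). S d z) \<in>
           (\<Pi>\<^sub>M k\<in>{1..K\<^sub>0}. seq_space (X \<Otimes>\<^sub>M Y)) \<Otimes>\<^sub>M (X \<Otimes>\<^sub>M Y) \<rightarrow>\<^sub>M borel"
  shows "\<P>(\<omega> in P. snd (hd (Z (K + 1) \<omega>)) \<in>
             hcp_set Y K\<^sub>0 K\<^sub>1 \<alpha> S (\<lambda>k. Z k \<omega>) (fst (hd (Z (K + 1) \<omega>)))) \<ge> 1 - \<alpha> \<and>
         ((AE \<omega> in P. inj_on (\<lambda>(k, i). S (\<lambda>k\<in>{1..K\<^sub>0}. Z k \<omega>) (Z k \<omega> ! i))
                      (SIGMA k:{K\<^sub>0 + 1..K + 1}. {..<length (Z k \<omega>)})) \<longrightarrow>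
          \<P>(\<omega> in P. snd (hd (Z (K + 1) \<omega>)) \<in>
             hcp_set Y K\<^sub>0 K\<^sub>1 \<alpha> S (\<lambda>k. Z k \<omega>) (fst (hd (Z (K + 1) \<omega>))))
            \<le> 1 - \<alpha> + 2 / (real K\<^sub>1 + 1))"
    (is "\<P>(\<omega> in P. ?covered \<omega>) \<ge> _ \<and> ((AE \<omega> in P. ?distinct \<omega>) \<longrightarrow> _)")
proof -
  interpret hierarchical_sample P "X \<Otimes>\<^sub>M Y" "K + 1" Z
    using assms(6-8) by (intro hierarchical_sample.intro hierarchical_sample_axioms.intro)
  define J where "J = {K\<^sub>0 + 1..K + 1}"
  define mass where "mass = trained_mass_below K\<^sub>0 J S"
  define s where "s \<omega> = S (\<lambda>k\<in>{1..K\<^sub>0}. sample \<omega> k)" for \<omega>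
  define calibration_mass where "calibration_mass zs z =
    (\<Sum>k = K\<^sub>0 + 1..K. mean (\<lambda>x. of_bool (S (\<lambda>k\<in>{1..K\<^sub>0}. zs k) x < S (\<lambda>k\<in>{1..K\<^sub>0}. zs k) z)) (zs k))
      / (real K\<^sub>1 + 1)" for zs z
  define test where "test \<omega> = hd (sample \<omega> (K + 1))" for \<omega>
  have J: "J \<subseteq> {K\<^sub>0 + 1..K + 1}" "J \<subseteq> {1..K + 1}" "K + 1 \<in> J" "finite J" "J \<noteq> {}"
    and card_J: "real (card J) = real K\<^sub>1 + 1"
    using \<open>K = K\<^sub>0 + K\<^sub>1\<close> by (auto simp: J_def)
  have sample_eq: "sample \<omega> k = Z k \<omega>" if "k \<in> {1..K + 1}" for \<omega> k
    using that unfolding sample_def by simp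
  have train_eq: "(\<lambda>k\<in>{1..K\<^sub>0}. sample \<omega> k) = (\<lambda>k\<in>{1..K\<^sub>0}. Z k \<omega>)" for \<omega>
    using \<open>K = K\<^sub>0 + K\<^sub>1\<close> unfolding sample_def by (auto simp: fun_eq_iff)
  have test_eq: "test \<omega> = hd (Z (K + 1) \<omega>)" for \<omega>
    unfolding test_def by (subst sample_eq) simp_all
  have ne: "sample \<omega> k \<noteq> []" if "\<omega> \<in> space P" "k \<in> J" for \<omega> k
    using sample_nonempty that J(2) by blast

  note mean_meas = borel_measurable_trained_mean[OF _ _ assms(9), of _ "K + 1"]
  have mass_meas: "(\<lambda>(zs, z). mass zs z) \<in> borel_measurable (group_space \<Otimes>\<^sub>M (X \<Otimes>\<^sub>M Y))"
    unfolding mass_def trained_mass_below_def mass_below_def hierarchical_mean_def case_prod_unfold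
    using \<open>K = K\<^sub>0 + K\<^sub>1\<close> J(2)
    by (intro borel_measurable_divide borel_measurable_sum borel_measurable_const
        mean_meas[unfolded case_prod_unfold]) auto
  have cal_meas: "(\<lambda>(zs, z). calibration_mass zs z) \<in> borel_measurable (group_space \<Otimes>\<^sub>M (X \<Otimes>\<^sub>M Y))"
    unfolding calibration_mass_def case_prod_unfold
    using \<open>K = K\<^sub>0 + K\<^sub>1\<close>
    by (intro borel_measurable_divide borel_measurable_sum borel_measurable_const
        mean_meas[unfolded case_prod_unfold]) auto
  have test_meas: "(\<lambda>\<omega>. (sample \<omega>, test \<omega>)) \<in> P \<rightarrow>\<^sub>M group_space \<Otimes>\<^sub>M (X \<Otimes>\<^sub>M Y)"
    unfolding test_def
    by (intro measurable_Pair measurable_sample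
        measurable_compose[OF measurable_sample_group measurable_hd_seq_space]) simp
  have [measurable]: "(\<lambda>\<omega>. mass (sample \<omega>) (test \<omega>)) \<in> borel_measurable P"
    "(\<lambda>\<omega>. calibration_mass (sample \<omega>) (test \<omega>)) \<in> borel_measurable P"
    using measurable_compose[OF test_meas mass_meas] measurable_compose[OF test_meas cal_meas]
    by simp_all

  have covered_iff: "?covered \<omega> \<longleftrightarrow> calibration_mass (sample \<omega>) (test \<omega>) < 1 - \<alpha>"
    if \<omega>: "\<omega> \<in> space P" for \<omega>
  proof -
    have "hd (Z (K + 1) \<omega>) \<in> space (X \<Otimes>\<^sub>M Y)"
      using measurable_space[OF measurable_hd_seq_space measurable_space[OF assms(7) \<omega>]] by simp
    then have "snd (hd (Z (K + 1) \<omega>)) \<in> space Y" by (auto simp: space_pair_measure)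
    moreover have "calibration_mass (sample \<omega>) (test \<omega>) =
        calibration_mass (\<lambda>k. Z k \<omega>) (hd (Z (K + 1) \<omega>))"
      unfolding calibration_mass_def train_eq test_eq
      by (intro arg_cong2[where f = "(/)"] sum.cong refl) (subst sample_eq; simp)
    ultimately show ?thesis
      using \<open>K = K\<^sub>0 + K\<^sub>1\<close> by (simp add: mem_hcp_set_iff calibration_mass_def)
  qed
  have mass_eq: "mass (sample \<omega>) (test \<omega>) = calibration_mass (sample \<omega>) (test \<omega>) +
      mean (\<lambda>x. of_bool (s \<omega> x < s \<omega> (test \<omega>))) (sample \<omega> (K + 1)) / (real K\<^sub>1 + 1)" for \<omega>
  proof -
    have "J = insert (K + 1) {K\<^sub>0 + 1..K}" using \<open>K = K\<^sub>0 + K\<^sub>1\<close> by (auto simp: J_def)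
    then have "(\<Sum>k\<in>J. f k) = f (K + 1) + (\<Sum>k = K\<^sub>0 + 1..K. f k)" for f :: "nat \<Rightarrow> real"
      by simp
    then show ?thesis
      unfolding mass_def trained_mass_below_def mass_below_def hierarchical_mean_def card_J
        calibration_mass_def s_def by (simp add: add_divide_distrib)
  qed
  have share: "0 \<le> mean (\<lambda>x. of_bool (s \<omega> x < s \<omega> (test \<omega>)) :: real) (sample \<omega> (K + 1))"
    "mean (\<lambda>x. of_bool (s \<omega> x < s \<omega> (test \<omega>)) :: real) (sample \<omega> (K + 1)) \<le> 1"
    if "\<omega> \<in> space P" for \<omega>
    using mean_bounds[OF ne[OF that J(3)]] by auto

  have average: "\<P>(\<omega> in P. Q (mass (sample \<omega>) (test \<omega>))) =
      expectation (\<lambda>\<omega>. hierarchical_mean J (\<lambda>z. of_bool (Q (mass (sample \<omega>) z))) (sample \<omega>))"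
    "integrable P (\<lambda>\<omega>. hierarchical_mean J (\<lambda>z. of_bool (Q (mass (sample \<omega>) z))) (sample \<omega>))"
    if Q: "Measurable.pred borel Q" for Q
  proof -
    have e: "Measurable.pred (group_space \<Otimes>\<^sub>M (X \<Otimes>\<^sub>M Y)) (\<lambda>(zs, z). Q (mass zs z))"
      using measurable_compose[OF mass_meas Q] by (simp add: case_prod_unfold)
    note sym = trained_mass_below_swap_groups[OF J(1)] trained_mass_below_permute_group[OF J(1)]
    show "\<P>(\<omega> in P. Q (mass (sample \<omega>) (test \<omega>))) =
      expectation (\<lambda>\<omega>. hierarchical_mean J (\<lambda>z. of_bool (Q (mass (sample \<omega>) z))) (sample \<omega>))"
      unfolding test_def
      by (rule prob_hd_eq_expectation_hierarchical_mean(1)[OF J(2,3) e])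
        (use J(3) in \<open>simp_all only: mass_def sym\<close>)
    show "integrable P (\<lambda>\<omega>. hierarchical_mean J (\<lambda>z. of_bool (Q (mass (sample \<omega>) z))) (sample \<omega>))"
      by (rule prob_hd_eq_expectation_hierarchical_mean(2)[OF J(2,3) e])
        (use J(3) in \<open>simp_all only: mass_def sym\<close>)
  qed

  have miss: "\<P>(\<omega> in P. 1 - \<alpha> \<le> mass (sample \<omega>) (test \<omega>)) \<le> \<alpha>"
  proof -
    have Q: "Measurable.pred borel (\<lambda>u::real. 1 - \<alpha> \<le> u)" by measurable
    have "hierarchical_mean J (\<lambda>z. of_bool (1 - \<alpha> \<le> mass (sample \<omega>) z)) (sample \<omega>) \<le> \<alpha>"
      if "\<omega> \<in> space P" for \<omega>
      unfolding mass_def trained_mass_below_def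
      using hierarchical_mean_high_rank_le[OF J(4,5) ne[OF that], where p = "1 - \<alpha>"] \<open>0 < \<alpha>\<close> by simp
    then show ?thesis
      unfolding average(1)[OF Q] by (intro integral_le_const average(2)[OF Q]) auto
  qed
  have "1 - \<alpha> \<le> 1 - \<P>(\<omega> in P. 1 - \<alpha> \<le> mass (sample \<omega>) (test \<omega>))" using miss by simp
  also have "\<dots> = \<P>(\<omega> in P. mass (sample \<omega>) (test \<omega>) < 1 - \<alpha>)"
  proof -
    have "{\<omega> \<in> space P. 1 - \<alpha> \<le> mass (sample \<omega>) (test \<omega>)} \<in> events" by measurable
    from prob_neg[OF this] show ?thesis by (simp only: not_le)
  qed
  also have "\<dots> \<le> \<P>(\<omega> in P. calibration_mass (sample \<omega>) (test \<omega>) < 1 - \<alpha>)"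
  proof (rule finite_measure_mono)
    have "calibration_mass (sample \<omega>) (test \<omega>) \<le> mass (sample \<omega>) (test \<omega>)" if "\<omega> \<in> space P" for \<omega>
      unfolding mass_eq using share(1)[OF that] by simp
    then show "{\<omega> \<in> space P. mass (sample \<omega>) (test \<omega>) < 1 - \<alpha>}
        \<subseteq> {\<omega> \<in> space P. calibration_mass (sample \<omega>) (test \<omega>) < 1 - \<alpha>}"
      by (auto intro: le_less_trans)
  qed measurable
  finally have lower: "1 - \<alpha> \<le> \<P>(\<omega> in P. calibration_mass (sample \<omega>) (test \<omega>) < 1 - \<alpha>)" .

  have upper: "\<P>(\<omega> in P. calibration_mass (sample \<omega>) (test \<omega>) < 1 - \<alpha>) \<le> 1 - \<alpha> + 2 / (real K\<^sub>1 + 1)"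
    if distinct: "AE \<omega> in P. ?distinct \<omega>"
  proof -
    (* coverage bounds the calibration weight; the test group may add up to one group weight *)
    define q where "q = 1 - \<alpha> + 1 / (real K\<^sub>1 + 1)"
    have Q: "Measurable.pred borel (\<lambda>u::real. u < q)" by measurable
    have "\<P>(\<omega> in P. calibration_mass (sample \<omega>) (test \<omega>) < 1 - \<alpha>) \<le> \<P>(\<omega> in P. mass (sample \<omega>) (test \<omega>) < q)"
    proof (rule finite_measure_mono)
      have "mass (sample \<omega>) (test \<omega>) \<le> calibration_mass (sample \<omega>) (test \<omega>) + 1 / (real K\<^sub>1 + 1)"
        if "\<omega> \<in> space P" for \<omega>
        unfolding mass_eq by (intro add_left_mono divide_right_mono share(2)[OF that]) simp
      then show "{\<omega> \<in> space P. calibration_mass (sample \<omega>) (test \<omega>) < 1 - \<alpha>}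
          \<subseteq> {\<omega> \<in> space P. mass (sample \<omega>) (test \<omega>) < q}"
        unfolding q_def by (auto intro: le_less_trans[OF _ add_strict_right_mono])
    qed measurable
    also have "\<dots> \<le> q + 1 / (real K\<^sub>1 + 1)"
      unfolding average(1)[OF Q]
    proof (rule integral_le_const[OF average(2)[OF Q]])
      show "AE \<omega> in P. hierarchical_mean J (\<lambda>z. of_bool (mass (sample \<omega>) z < q)) (sample \<omega>)
          \<le> q + 1 / (real K\<^sub>1 + 1)"
        using distinct
      proof (rule AE_mp, intro AE_I2 impI)
        fix \<omega> assume \<omega>: "\<omega> \<in> space P" and distinct_\<omega>: "?distinct \<omega>"
        have "(SIGMA k:J. {..<length (sample \<omega> k)}) =
            (SIGMA k:{K\<^sub>0 + 1..K + 1}. {..<length (Z k \<omega>)})"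
          using J(2) unfolding J_def by (intro Sigma_cong refl) (subst sample_eq; blast)
        moreover have "inj_on (\<lambda>(k, i). s \<omega> (sample \<omega> k ! i)) D \<longleftrightarrow>
            inj_on (\<lambda>(k, i). S (\<lambda>k\<in>{1..K\<^sub>0}. Z k \<omega>) (Z k \<omega> ! i)) D"
          if "fst ` D \<subseteq> {1..K + 1}" for D
        proof (rule inj_on_cong)
          fix x assume "x \<in> D"
          then have "sample \<omega> (fst x) = Z (fst x) \<omega>" using that by (intro sample_eq) blast
          then show "(case x of (k, i) \<Rightarrow> s \<omega> (sample \<omega> k ! i)) =
              (case x of (k, i) \<Rightarrow> S (\<lambda>k\<in>{1..K\<^sub>0}. Z k \<omega>) (Z k \<omega> ! i))"
            unfolding s_def train_eq case_prod_unfold by simp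
        qed
        moreover have "fst ` (SIGMA k:{K\<^sub>0 + 1..K + 1}. {..<length (Z k \<omega>)}) \<subseteq> {1..K + 1}"
          by auto
        ultimately have "inj_on (\<lambda>(k, i). s \<omega> (sample \<omega> k ! i)) (SIGMA k:J. {..<length (sample \<omega> k)})"
          using distinct_\<omega> by (simp only:)
        moreover have "0 \<le> q" using \<open>\<alpha> < 1\<close> by (simp add: q_def)
        ultimately show "hierarchical_mean J (\<lambda>z. of_bool (mass (sample \<omega>) z < q)) (sample \<omega>)
            \<le> q + 1 / (real K\<^sub>1 + 1)"
          using hierarchical_mean_low_rank_le[OF J(4,5) ne[OF \<omega>], where q = q and s = "s \<omega>"]
          unfolding mass_def trained_mass_below_def s_def card_J by simp
      qed
    qed
    finally show ?thesis by (simp add: q_def)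
  qed
  have "{\<omega> \<in> space P. ?covered \<omega>} = {\<omega> \<in> space P. calibration_mass (sample \<omega>) (test \<omega>) < 1 - \<alpha>}"
    using covered_iff by blast
  then show ?thesis using lower upper by simp
qed

end
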